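(* Let $p$ be an even positive integer. The set of $\{\alpha_j\}_{j=0}^{p-1}\in\mathbb{D}^p$ for which the discriminant $\Delta(z)=\Delta(z,\{\alpha_j\}_{j=0}^{p-1})$ has all gaps open is a dense open subset of $\mathbb{D}^p$.
   Context: $\mathbb{D}=\{|z|<1\}$. For $\alpha\in\mathbb{D}$ and $\rho=(1-|\alpha|^2)^{1/2}$ let $A(\alpha,z)=\rho^{-1}\begin{pmatrix}z&-\bar\alpha\\-\alpha z&1\end{pmatrix}$. For $\{\alpha_j\}_{j=0}^{p-1}\in\mathbb{D}^p$ put $T_p(z)=A(\alpha_{p-1},z)A(\alpha_{p-2},z)\cdots A(\alpha_0,z)$ and define the discriminant $\Delta(z,\{\alpha_j\}_{j=0}^{p-1})=z^{-p/2}\operatorname{Tr}(T_p(z))$, which is real for $z\in\partial\mathbb{D}$. The set $\{z\in\partial\mathbb{D}\mid\Delta(z)\in(-2,2)\}$ consists of $p$ disjoint open arcs whose closures $B_1,\dots,B_p$ (the bands) can overlap at most in single points (endpoints). Between cyclically consecutive bands there is a gap; it is open if it is a nonempty arc on which $|\Delta(z)|>2$, and closed if the two bands touch there. All gaps are open when there are $p$ open gaps, i.e. $\{z\in\partial\mathbb{D}\mid|\Delta(z)|>2\}$ has exactly $p$ connected components. *)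

theory Defs
  imports "HOL-Analysis.Analysis"
begin

definition rho :: "complex \<Rightarrow> real"
  where "rho \<alpha> = sqrt (1 - (cmod \<alpha>)\<^sup>2)"

definition szego_matrix :: "complex \<Rightarrow> complex \<Rightarrow> complex^2^2"
  where "szego_matrix \<alpha> z =
    inverse (rho \<alpha>) *\<^sub>R vector [vector [z, - cnj \<alpha>], vector [- \<alpha> * z, 1]]"

fun transfer_matrix :: "nat \<Rightarrow> (nat \<Rightarrow> complex) \<Rightarrow> complex \<Rightarrow> complex^2^2"
  where
    "transfer_matrix 0 \<alpha> z = mat 1"
  | "transfer_matrix (Suc n) \<alpha> z = szego_matrix (\<alpha> n) z ** transfer_matrix n \<alpha> z"

text \<open>The discriminant of period \<open>p\<close>. It is meant for even \<open>p\<close>, where the prefactor is an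
  honest integer power. On the unit circle it takes real values, so that \<open>cmod\<close> of it below
  is the ordinary absolute value.\<close>

definition discriminant :: "nat \<Rightarrow> (nat \<Rightarrow> complex) \<Rightarrow> complex \<Rightarrow> complex"
  where "discriminant p \<alpha> z = z powi (- (int p div 2)) * trace (transfer_matrix p \<alpha> z)"

definition open_gaps :: "nat \<Rightarrow> (nat \<Rightarrow> complex) \<Rightarrow> complex set set"
  where "open_gaps p \<alpha> = components {z \<in> sphere 0 1. cmod (discriminant p \<alpha> z) > 2}"

text \<open>For \<open>p > 0\<close> the equation also says that there are only finitely many open gaps.\<close>

definition all_gaps_open :: "nat \<Rightarrow> (nat \<Rightarrow> complex) \<Rightarrow> bool"
  where "all_gaps_open p \<alpha> \<longleftrightarrow> card (open_gaps p \<alpha>) = p"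

text \<open>The \<open>p\<close>-fold power of the open unit disk with its product topology. Its points are the
  extensional functions on \<open>{..<p}\<close> with values in the disk (\<open>undefined\<close> outside \<open>{..<p}\<close>).\<close>

definition polydisk :: "nat \<Rightarrow> (nat \<Rightarrow> complex) topology"
  where "polydisk p = product_topology (\<lambda>_. top_of_set (ball 0 1)) {..<p}"

end

theory Submission
  imports Defs "HOL-Computational_Algebra.Fundamental_Theorem_Algebra"
begin

text \<open>
  Along the unit circle the discriminant is a real periodic function with at most \<open>p\<close> critical
  points. With \<open>T\<^sub>k\<close> the partial products and \<open>J = diag(1, -1)\<close>, the angular derivative of
  \<open>z\<^bsup>-p/2\<^esup> T\<^sub>p\<close> is a multiple of \<open>T\<^sub>p J P\<close>, where \<open>P\<close>, the sum of \<open>T\<^sub>k\<^sup>* T\<^sub>k\<close> over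
  \<open>k < p\<close>, is positive definite. Hence at a critical point where \<open>\<Delta>\<close> lies in \<open>[-2, 2]\<close> the
  matrix \<open>T\<^sub>p\<close> is scalar.

  Every open gap contains a critical point, so there are at most \<open>p\<close> open gaps, and if there are
  \<open>p\<close> of them then \<open>|\<Delta>| > 2\<close> at every critical point. In that case the \<open>p\<close> zeros of \<open>\<Delta>\<close>, which
  all lie on the circle, are simple, and by Rolle's theorem they interlace with \<open>p\<close> points where
  \<open>|\<Delta>| > 2\<close>. Conversely, such an interlacing of points with \<open>|\<Delta>| < 2\<close> and \<open>|\<Delta>| > 2\<close>
  separates \<open>p\<close> gaps, and it is stable under perturbation, which gives openness.

  For density, freeze all parameters but the last. If \<open>T\<^sub>p(z)\<close> is scalar, then its lower left entry
  vanishes, which makes the last parameter a fixed smooth function of \<open>z\<close>. So the exceptional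
  values of this parameter lie on a smooth curve, a null set in the disk.
\<close>

subsection \<open>Entries of the transfer matrix\<close>

text \<open>The two components of the transfer matrix applied to \<open>(u, v)\<close>, as polynomials in \<open>z\<close>.\<close>

fun tcol_fst tcol_snd :: "(nat \<Rightarrow> complex) \<Rightarrow> complex \<Rightarrow> complex \<Rightarrow> nat \<Rightarrow> complex poly" where
  "tcol_fst \<alpha> u v 0 = [:u:]"
| "tcol_snd \<alpha> u v 0 = [:v:]"
| "tcol_fst \<alpha> u v (Suc n) = smult (inverse (rho (\<alpha> n)))
    (pCons 0 (tcol_fst \<alpha> u v n) - smult (cnj (\<alpha> n)) (tcol_snd \<alpha> u v n))"
| "tcol_snd \<alpha> u v (Suc n) = smult (inverse (rho (\<alpha> n)))
    (tcol_snd \<alpha> u v n - smult (\<alpha> n) (pCons 0 (tcol_fst \<alpha> u v n)))"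

abbreviation "ta \<alpha> \<equiv> tcol_fst \<alpha> 1 0"
abbreviation "tb \<alpha> \<equiv> tcol_fst \<alpha> 0 1"
abbreviation "tc \<alpha> \<equiv> tcol_snd \<alpha> 1 0"
abbreviation "td \<alpha> \<equiv> tcol_snd \<alpha> 0 1"

lemma szego_matrix_entries:
  "szego_matrix \<alpha> z $ 1 $ 1 = of_real (inverse (rho \<alpha>)) * z"
  "szego_matrix \<alpha> z $ 1 $ 2 = of_real (inverse (rho \<alpha>)) * - cnj \<alpha>"
  "szego_matrix \<alpha> z $ 2 $ 1 = of_real (inverse (rho \<alpha>)) * (- \<alpha> * z)"
  "szego_matrix \<alpha> z $ 2 $ 2 = of_real (inverse (rho \<alpha>))"
  by (simp_all add: szego_matrix_def vector_2 scaleR_conv_of_real[where 'a = complex])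

lemma transfer_matrix_entries:
  "transfer_matrix n \<alpha> z $ 1 $ 1 = poly (ta \<alpha> n) z"
  "transfer_matrix n \<alpha> z $ 1 $ 2 = poly (tb \<alpha> n) z"
  "transfer_matrix n \<alpha> z $ 2 $ 1 = poly (tc \<alpha> n) z"
  "transfer_matrix n \<alpha> z $ 2 $ 2 = poly (td \<alpha> n) z"
  by (induction n)
    (simp_all add: mat_def szego_matrix_entries matrix_matrix_mult_def sum_2 algebra_simps)

definition trace_poly :: "nat \<Rightarrow> (nat \<Rightarrow> complex) \<Rightarrow> complex poly"
  where "trace_poly n \<alpha> = ta \<alpha> n + td \<alpha> n"

lemma discriminant_trace_poly:
  "discriminant p \<alpha> z = z powi (- (int p div 2)) * poly (trace_poly p \<alpha>) z"
  by (simp add: discriminant_def trace_poly_def trace_def sum_2 transfer_matrix_entries)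

lemma poly_tcol_Suc:
  "poly (tcol_fst \<alpha> u v (Suc n)) z = of_real (inverse (rho (\<alpha> n)))
     * (z * poly (tcol_fst \<alpha> u v n) z - cnj (\<alpha> n) * poly (tcol_snd \<alpha> u v n) z)"
  "poly (tcol_snd \<alpha> u v (Suc n)) z = of_real (inverse (rho (\<alpha> n)))
     * (poly (tcol_snd \<alpha> u v n) z - \<alpha> n * (z * poly (tcol_fst \<alpha> u v n) z))"
  by simp_all

lemma tcol_cong:
  assumes "\<And>i. i < n \<Longrightarrow> \<alpha> i = \<beta> i"
  shows "tcol_fst \<alpha> u v n = tcol_fst \<beta> u v n" "tcol_snd \<alpha> u v n = tcol_snd \<beta> u v n"
  using assms by (induction n) simp_all

lemma tcol_linear:
  "poly (tcol_fst \<alpha> u v n) z = u * poly (ta \<alpha> n) z + v * poly (tb \<alpha> n) z"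
  "poly (tcol_snd \<alpha> u v n) z = u * poly (tc \<alpha> n) z + v * poly (td \<alpha> n) z"
  by (induction n) (simp_all add: algebra_simps)

lemma rho_sq:
  assumes "cmod \<alpha> < 1"
  shows "rho \<alpha> > 0" "(rho \<alpha>)\<^sup>2 = 1 - (cmod \<alpha>)\<^sup>2"
  using assms by (auto simp: rho_def abs_square_less_1 power_le_one)

text \<open>Each factor has determinant z, because \<open>rho\<close> squared is 1 -
  |\<alpha>|^2.\<close>

lemma det_transfer:
  assumes "\<forall>i<n. cmod (\<alpha> i) < 1"
  shows "poly (ta \<alpha> n) z * poly (td \<alpha> n) z - poly (tb \<alpha> n) z * poly (tc \<alpha> n) z = z ^ n"
  using assms
proof (induction n)
  case (Suc n)
  let ?a = "poly (ta \<alpha> n) z" and ?b = "poly (tb \<alpha> n) z"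
  let ?c = "poly (tc \<alpha> n) z" and ?d = "poly (td \<alpha> n) z"
  let ?r = "complex_of_real (rho (\<alpha> n))"
  have r: "?r \<noteq> 0" "?r\<^sup>2 = 1 - \<alpha> n * cnj (\<alpha> n)"
    using rho_sq[of "\<alpha> n"] Suc.prems
    by (auto simp: complex_norm_square[symmetric] simp flip: of_real_power)
  have "poly (ta \<alpha> (Suc n)) z * poly (td \<alpha> (Suc n)) z - poly (tb \<alpha> (Suc n)) z * poly (tc \<alpha> (Suc n)) z
      = (1 - \<alpha> n * cnj (\<alpha> n)) * z * (?a * ?d - ?b * ?c) / ?r\<^sup>2"
    using r(1) by (simp add: field_simps power2_eq_square)
  also have "\<dots> = z ^ Suc n"
    using Suc r by (simp flip: r(2))
  finally show ?case .
qed simp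

lemma cnj_mult_self: "cmod z = 1 \<Longrightarrow> z * cnj z = 1"
  by (simp add: complex_norm_square[symmetric])

text \<open>For |z| = 1, conjugating the entries of one factor and multiplying by z swaps its rows
  and its columns; this symmetry passes to products, with z^n in place of z.\<close>

lemma tcol_reversal:
  assumes "cmod z = 1"
  shows "poly (tc \<alpha> n) z = z ^ n * cnj (poly (tb \<alpha> n) z)"
    "poly (td \<alpha> n) z = z ^ n * cnj (poly (ta \<alpha> n) z)"
proof -
  have z: "z * cnj z = 1" using assms by (rule cnj_mult_self)
  \<comment> \<open>The last two equations are the first two solved for the other entry. Carrying
    all four makes the induction step a plain identity.\<close>
  have "poly (tc \<alpha> n) z = z ^ n * cnj (poly (tb \<alpha> n) z) \<and> poly (td \<alpha> n) z = z ^ n * cnj (poly (ta \<alpha> n) z)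
     \<and> z ^ n * cnj (poly (tc \<alpha> n) z) = poly (tb \<alpha> n) z \<and> z ^ n * cnj (poly (td \<alpha> n) z) = poly (ta \<alpha> n) z"
  proof (induction n)
    case (Suc n)
    have step1: "of_real k * (c - \<beta> * (z * a)) = z * w * cnj (of_real k * (z * b - cnj \<beta> * d))"
      if "c = w * cnj b" "a = w * cnj d" for a b c d w \<beta> k
      using that z unfolding complex_cnj_mult complex_cnj_diff complex_cnj_cnj complex_cnj_complex_of_real
      by algebra
    have step2: "z * w * cnj (of_real k * (c - \<beta> * (z * a))) = of_real k * (z * b - cnj \<beta> * d)"
      if "b = w * cnj c" "d = w * cnj a" for a b c d w \<beta> k
      using that z unfolding complex_cnj_mult complex_cnj_diff complex_cnj_cnj complex_cnj_complex_of_real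
      by algebra
    show ?case
      unfolding poly_tcol_Suc power_Suc by (intro conjI step1 step2) (use Suc in auto)
  qed simp
  then show "poly (tc \<alpha> n) z = z ^ n * cnj (poly (tb \<alpha> n) z)"
    "poly (td \<alpha> n) z = z ^ n * cnj (poly (ta \<alpha> n) z)" by auto
qed

section \<open>The indefinite form and the zeros of the trace\<close>

definition indef_form :: "complex \<Rightarrow> complex \<Rightarrow> real" where
  "indef_form u v = (cmod u)\<^sup>2 - (cmod v)\<^sup>2"

text \<open>The matrix is diag(z, 1) followed by a hyperbolic rotation that preserves the form of J
  = diag(1, -1), so only diag(z, 1) changes the value.\<close>

lemma indef_form_step:
  fixes \<alpha> u v z :: complex
  assumes "cmod \<alpha> < 1"
  shows "indef_form (of_real (inverse (rho \<alpha>)) * (z * u - cnj \<alpha> * v))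
      (of_real (inverse (rho \<alpha>)) * (v - \<alpha> * (z * u)))
    = indef_form (z * u) v"
proof -
  have "(cmod (w - cnj \<alpha> * v))\<^sup>2 - (cmod (v - \<alpha> * w))\<^sup>2
      = (1 - (cmod \<alpha>)\<^sup>2) * ((cmod w)\<^sup>2 - (cmod v)\<^sup>2)" for w
    by (simp add: cmod_power2, algebra)
  then have "indef_form (w - cnj \<alpha> * v) (v - \<alpha> * w) = (rho \<alpha>)\<^sup>2 * indef_form w v" for w
    by (simp add: indef_form_def rho_sq[OF assms])
  moreover have "indef_form (of_real (inverse (rho \<alpha>)) * s) (of_real (inverse (rho \<alpha>)) * t) = indef_form s t / (rho \<alpha>)\<^sup>2" for s t
    by (simp add: indef_form_def norm_mult norm_inverse power_mult_distrib power_inverse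
        divide_inverse left_diff_distrib mult.commute[of "inverse _"] del: of_real_inverse)
  ultimately show ?thesis using rho_sq(1)[OF assms] by simp
qed

text \<open>The sign of the defect is that of \<open>|z| - 1\<close>, so off the circle the form cannot return to
  \<open>|z|\<^bsup>2n\<^esup>\<close> times its value after two applications. A vanishing trace would force this, since
  then \<open>T\<^sub>n\<^sup>2 = -z\<^sup>n\<close> by Cayley-Hamilton.\<close>

lemma indef_form_transfer:
  assumes "\<forall>i<n. cmod (\<alpha> i) < 1" and "z \<noteq> 0"
  shows "\<exists>s\<ge>0. (n > 0 \<longrightarrow> (u, v) \<noteq> (0, 0) \<longrightarrow> s > 0) \<and>
    indef_form (poly (tcol_fst \<alpha> u v n) z) (poly (tcol_snd \<alpha> u v n) z)
    = cmod z ^ n * indef_form u v + (cmod z - 1) * s"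
  using assms(1)
proof (induction n)
  case 0
  then show ?case by (auto intro!: exI[of _ 0])
next
  case (Suc n)
  then obtain s where s: "s \<ge> 0" "n > 0 \<longrightarrow> (u, v) \<noteq> (0, 0) \<longrightarrow> s > 0"
    "indef_form (poly (tcol_fst \<alpha> u v n) z) (poly (tcol_snd \<alpha> u v n) z)
    = cmod z ^ n * indef_form u v + (cmod z - 1) * s" by auto
  let ?u = "poly (tcol_fst \<alpha> u v n) z" and ?v = "poly (tcol_snd \<alpha> u v n) z"
  \<comment> \<open>Splitting |z| times the form off |zu|^2 - |v|^2 leaves (|z| - 1)(|z||u|^2 +
    |v|^2). The second factor is the new contribution to the defect.\<close>
  let ?s = "cmod z * s + (cmod z * (cmod ?u)\<^sup>2 + (cmod ?v)\<^sup>2)"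
  have "indef_form (poly (tcol_fst \<alpha> u v (Suc n)) z) (poly (tcol_snd \<alpha> u v (Suc n)) z)
      = indef_form (z * ?u) ?v"
    using indef_form_step[of "\<alpha> n" z ?u ?v] Suc.prems by (simp add: mult.left_commute)
  also have "\<dots> = cmod z * indef_form ?u ?v + (cmod z - 1) * (cmod z * (cmod ?u)\<^sup>2 + (cmod ?v)\<^sup>2)"
    by (simp add: indef_form_def norm_mult power2_eq_square algebra_simps)
  also have "\<dots> = cmod z ^ Suc n * indef_form u v + (cmod z - 1) * ?s"
    unfolding s(3) by (simp add: algebra_simps)
  finally have eq: "indef_form (poly (tcol_fst \<alpha> u v (Suc n)) z) (poly (tcol_snd \<alpha> u v (Suc n)) z)
    = cmod z ^ Suc n * indef_form u v + (cmod z - 1) * ?s" .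
  have z: "cmod z > 0" using assms by simp
  have "?s > 0" if "(u, v) \<noteq> (0, 0)"
  proof (cases "n = 0")
    case True
    have "cmod z * (cmod ?u)\<^sup>2 > 0 \<or> (cmod ?v)\<^sup>2 > 0"
      using True that z by auto
    moreover have "cmod z * (cmod ?u)\<^sup>2 \<ge> 0" "(cmod ?v)\<^sup>2 \<ge> 0" "cmod z * s \<ge> 0" using s by auto
    ultimately show ?thesis by linarith
  next
    case False
    then have "cmod z * s > 0" using that s z by simp
    moreover have "cmod z * (cmod ?u)\<^sup>2 \<ge> 0" "(cmod ?v)\<^sup>2 \<ge> 0" by auto
    ultimately show ?thesis by linarith
  qed
  moreover have "?s \<ge> 0" using s by simp
  ultimately show ?case using eq by blast
qed

text \<open>On the circle the defect in \<open>indef_form_transfer\<close> vanishes, so the image of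
  (0, 1) keeps the value -1. Reversal gives its second component the modulus of the upper left
  entry.\<close>

lemma tcol_norm:
  assumes "\<forall>i<n. cmod (\<alpha> i) < 1" and "cmod z = 1"
  shows "(cmod (poly (ta \<alpha> n) z))\<^sup>2 = 1 + (cmod (poly (tb \<alpha> n) z))\<^sup>2"
proof -
  have "z \<noteq> 0" using assms by auto
  then have "indef_form (poly (tb \<alpha> n) z) (poly (td \<alpha> n) z) = -1"
    using indef_form_transfer[OF assms(1), of z 0 1] assms(2) by (auto simp: indef_form_def)
  then show ?thesis
    using tcol_reversal[OF assms(2), of \<alpha> n] assms(2) by (simp add: indef_form_def norm_mult norm_power)
qed

lemma trace_poly_root_norm:
  assumes "\<forall>i<n. cmod (\<alpha> i) < 1" and "n > 0" and "z \<noteq> 0" and "poly (trace_poly n \<alpha>) z = 0"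
  shows "cmod z = 1"
proof -
  let ?a = "poly (ta \<alpha> n) z" and ?b = "poly (tb \<alpha> n) z"
  let ?c = "poly (tc \<alpha> n) z" and ?d = "poly (td \<alpha> n) z"
  have tr: "?a = - ?d" using assms(4) by (simp add: trace_poly_def eq_neg_iff_add_eq_0)
  obtain s where s: "s > 0" "indef_form ?b ?d = cmod z ^ n * indef_form 0 1 + (cmod z - 1) * s"
    using indef_form_transfer[OF assms(1,3), of 0 1] assms(2) by auto
  obtain t where t: "t \<ge> 0" "indef_form (poly (tcol_fst \<alpha> ?b ?d n) z) (poly (tcol_snd \<alpha> ?b ?d n) z)
      = cmod z ^ n * indef_form ?b ?d + (cmod z - 1) * t"
    using indef_form_transfer[OF assms(1,3), of ?b ?d] by auto
  \<comment> \<open>Cayley-Hamilton for trace zero: with a = -d, two applications send (0, 1) to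
    -z^n (0, 1).\<close>
  have "poly (tcol_fst \<alpha> ?b ?d n) z = 0"
    by (simp add: tcol_linear[of \<alpha> ?b ?d] tr algebra_simps)
  moreover have "poly (tcol_snd \<alpha> ?b ?d n) z = - (z ^ n)"
    unfolding tcol_linear[of \<alpha> ?b ?d] det_transfer[OF assms(1), of z, symmetric] tr
    by (simp add: algebra_simps)
  ultimately have "indef_form (poly (tcol_fst \<alpha> ?b ?d n) z) (poly (tcol_snd \<alpha> ?b ?d n) z)
      = cmod z ^ n * (cmod z ^ n * indef_form 0 1)"
    by (simp add: indef_form_def norm_power power2_eq_square)
  then have *: "cmod z ^ n * (cmod z ^ n * indef_form 0 1 + (cmod z - 1) * s) + (cmod z - 1) * t
      = cmod z ^ n * (cmod z ^ n * indef_form 0 1)"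
    unfolding t(2) s(2) .
  have "(cmod z - 1) * (cmod z ^ n * s + t)
      = cmod z ^ n * (cmod z ^ n * indef_form 0 1 + (cmod z - 1) * s) + (cmod z - 1) * t
        - cmod z ^ n * (cmod z ^ n * indef_form 0 1)"
    by (simp add: algebra_simps)
  then have "(cmod z - 1) * (cmod z ^ n * s + t) = 0" unfolding * by simp
  moreover have "cmod z ^ n * s + t > 0" using s t assms(3) by (simp add: add_pos_nonneg)
  ultimately show ?thesis by simp
qed

section \<open>Values at the origin, degrees and leading coefficients\<close>

text \<open>At z = 0 the trace reduces to the lower right entry, a product of factors
  1/\<open>rho\<close>. This excludes the root 0, the case left open by
  \<open>trace_poly_root_norm\<close>.\<close>

lemma poly_tcol_0:
  assumes "\<forall>i<n. cmod (\<alpha> i) < 1"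
  shows "poly (tc \<alpha> n) 0 = 0" "n > 0 \<Longrightarrow> poly (ta \<alpha> n) 0 = 0" "poly (td \<alpha> n) 0 \<noteq> 0"
proof -
  show c: "poly (tc \<alpha> n) 0 = 0" for n by (induction n) auto
  show "n > 0 \<Longrightarrow> poly (ta \<alpha> n) 0 = 0" by (cases n) (auto simp: c)
  show "poly (td \<alpha> n) 0 \<noteq> 0" using assms
    by (induction n) (use rho_sq(1) in \<open>auto simp: less_Suc_eq\<close>, fastforce)
qed

lemma degree_tcol: "degree (tcol_fst \<alpha> u v n) \<le> n" "degree (tcol_snd \<alpha> u v n) \<le> n"
proof -
  have "degree (tcol_fst \<alpha> u v n) \<le> n \<and> degree (tcol_snd \<alpha> u v n) \<le> n"
    by (induction n) (auto intro!: degree_diff_le order.trans[OF degree_smult_le]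
        order.trans[OF degree_pCons_le])
  then show "degree (tcol_fst \<alpha> u v n) \<le> n" "degree (tcol_snd \<alpha> u v n) \<le> n" by auto
qed

lemma coeff_tcol:
  assumes "\<forall>i<n. cmod (\<alpha> i) < 1"
  shows "coeff (ta \<alpha> n) n \<noteq> 0" "n > 0 \<Longrightarrow> coeff (td \<alpha> n) n = 0"
proof -
  show "coeff (ta \<alpha> n) n \<noteq> 0" using assms
  proof (induction n)
    case (Suc n)
    have "coeff (tc \<alpha> n) (Suc n) = 0" using degree_tcol(2)[of \<alpha> 1 0 n] by (intro coeff_eq_0) simp
    then show ?case using Suc rho_sq(1)[of "\<alpha> n"] by auto
  qed simp
  \<comment> \<open>The claim on \<open>tb\<close> is what makes the induction for \<open>td\<close>
    go through.\<close>
  have "coeff (tb \<alpha> n) n = 0 \<and> (n > 0 \<longrightarrow> coeff (td \<alpha> n) n = 0)"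
  proof (induction n)
    case (Suc n)
    have "coeff (td \<alpha> n) (Suc n) = 0" using degree_tcol(2)[of \<alpha> 0 1 n] by (intro coeff_eq_0) simp
    then show ?case using Suc by auto
  qed simp
  then show "n > 0 \<Longrightarrow> coeff (td \<alpha> n) n = 0" by simp
qed

text \<open>The top coefficient comes from the upper left entry alone. The exact degree later yields
  p zeros of the discriminant.\<close>

lemma coeff_trace_poly:
  assumes "\<forall>i<n. cmod (\<alpha> i) < 1" "n > 0"
  shows "coeff (trace_poly n \<alpha>) n \<noteq> 0" "degree (trace_poly n \<alpha>) = n"
proof -
  show c: "coeff (trace_poly n \<alpha>) n \<noteq> 0" using coeff_tcol[OF assms(1)] assms(2) by (simp add: trace_poly_def)
  have "degree (trace_poly n \<alpha>) \<le> n"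
    unfolding trace_poly_def by (intro degree_add_le degree_tcol)
  with c show "degree (trace_poly n \<alpha>) = n" by (simp add: le_antisym le_degree)
qed

lemma trace_poly_roots_in_sphere:
  assumes "\<forall>i<n. cmod (\<alpha> i) < 1" and "n > 0" and "poly (trace_poly n \<alpha>) z = 0"
  shows "cmod z = 1"
proof -
  have "z \<noteq> 0" using poly_tcol_0[OF assms(1)] assms by (auto simp: trace_poly_def)
  then show ?thesis using trace_poly_root_norm assms by blast
qed

section \<open>The angular derivative and critical points\<close>

text \<open>On \<open>z = cis \<theta>\<close> this is \<open>-\<i> z\<^bsup>n/2\<^esup>\<close> times the \<open>\<theta>\<close>-derivative of \<open>z\<^bsup>-n/2\<^esup> q(z)\<close>.\<close>

definition crit_op :: "nat \<Rightarrow> complex poly \<Rightarrow> complex poly" where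
  "crit_op n q = pCons 0 (pderiv q) - smult (of_nat n / 2) q"

lemma crit_op_add: "crit_op n (p + q) = crit_op n p + crit_op n q"
  by (simp add: crit_op_def pderiv_add smult_add_right)

text \<open>The operator multiplies the coefficient of z^k by k - n/2, so the leading one survives.
  This bounds the number of critical points by n.\<close>

lemma crit_op_trace_poly:
  assumes "\<forall>i<n. cmod (\<alpha> i) < 1" "n > 0"
  shows "crit_op n (trace_poly n \<alpha>) \<noteq> 0" "degree (crit_op n (trace_poly n \<alpha>)) \<le> n"
proof -
  let ?q = "trace_poly n \<alpha>"
  have "coeff (crit_op n ?q) n = of_nat n / 2 * coeff ?q n"
    using assms(2) by (cases n) (simp_all add: crit_op_def coeff_pderiv algebra_simps)
  then have "coeff (crit_op n ?q) n \<noteq> 0" using coeff_trace_poly(1)[OF assms] assms(2)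
    by (metis divide_eq_0_iff mult_eq_0_iff of_nat_eq_0_iff not_gr_zero zero_neq_numeral)
  then show "crit_op n ?q \<noteq> 0" by auto
  show "degree (crit_op n ?q) \<le> n"
    using coeff_trace_poly(2)[OF assms] assms(2) unfolding crit_op_def
    by (intro degree_diff_le) (auto simp: degree_pderiv intro: order.trans[OF degree_smult_le] order.trans[OF degree_pCons_le])
qed

text \<open>Product rule for the normalized factor: it contains diag(z^(1/2), z^(-1/2)), whose
  logarithmic derivative contributes U/2 and -V/2.\<close>

lemma crit_op_tcol_Suc:
  fixes \<alpha> :: "nat \<Rightarrow> complex" and u v z :: complex and n :: nat
  defines "U \<equiv> poly (tcol_fst \<alpha> u v n) z" and "V \<equiv> poly (tcol_snd \<alpha> u v n) z"
    and "U' \<equiv> poly (crit_op n (tcol_fst \<alpha> u v n)) z" and "V' \<equiv> poly (crit_op n (tcol_snd \<alpha> u v n)) z"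
  shows "poly (crit_op (Suc n) (tcol_fst \<alpha> u v (Suc n))) z
      = of_real (inverse (rho (\<alpha> n))) * (z * (U' + U / 2) - cnj (\<alpha> n) * (V' - V / 2))"
    "poly (crit_op (Suc n) (tcol_snd \<alpha> u v (Suc n))) z
      = of_real (inverse (rho (\<alpha> n))) * ((V' - V / 2) - \<alpha> n * (z * (U' + U / 2)))"
proof -
  have *: "poly (crit_op (Suc n) (tcol_fst \<alpha> u v (Suc n))) z
      = k * (z * (U' + U / 2) - cnj (\<alpha> n) * (V' - V / 2))"
    "poly (crit_op (Suc n) (tcol_snd \<alpha> u v (Suc n))) z
      = k * ((V' - V / 2) - \<alpha> n * (z * (U' + U / 2)))"
    if "k = of_real (inverse (rho (\<alpha> n)))" for k :: complex
    unfolding assms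
    by (simp_all add: crit_op_def pderiv_smult pderiv_diff pderiv_pCons algebra_simps add_divide_distrib
        diff_divide_distrib flip: that del: of_real_inverse)
  show "poly (crit_op (Suc n) (tcol_fst \<alpha> u v (Suc n))) z
      = of_real (inverse (rho (\<alpha> n))) * (z * (U' + U / 2) - cnj (\<alpha> n) * (V' - V / 2))"
    "poly (crit_op (Suc n) (tcol_snd \<alpha> u v (Suc n))) z
      = of_real (inverse (rho (\<alpha> n))) * ((V' - V / 2) - \<alpha> n * (z * (U' + U / 2)))"
    using * by blast+
qed

text \<open>The numbers \<open>x\<close> and \<open>y\<close> are the diagonal and upper right entries of the Hermitian matrix
  \<open>P\<close>, the sum of \<open>T\<^sub>k\<^sup>* T\<^sub>k\<close> over \<open>k < n\<close>. The two diagonal entries agree because \<open>T\<^sub>k\<close> is in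
  \<open>U(1,1)\<close> on the circle.\<close>

lemma crit_op_entries:
  assumes "\<forall>i<n. cmod (\<alpha> i) < 1" and "cmod z = 1"
  shows "\<exists>x y. (n > 0 \<longrightarrow> cmod y < x) \<and> (n = 0 \<longrightarrow> x = 0 \<and> y = 0)
    \<and> 2 * poly (crit_op n (ta \<alpha> n)) z = of_real x * poly (ta \<alpha> n) z - cnj y * poly (tb \<alpha> n) z
    \<and> 2 * poly (crit_op n (tc \<alpha> n)) z = of_real x * poly (tc \<alpha> n) z - cnj y * poly (td \<alpha> n) z
    \<and> 2 * poly (crit_op n (tb \<alpha> n)) z = y * poly (ta \<alpha> n) z - of_real x * poly (tb \<alpha> n) z
    \<and> 2 * poly (crit_op n (td \<alpha> n)) z = y * poly (tc \<alpha> n) z - of_real x * poly (td \<alpha> n) z"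
  using assms(1)
proof (induction n)
  case 0
  show ?case by (auto simp: crit_op_def)
next
  case (Suc n)
  let ?a = "poly (ta \<alpha> n) z" and ?b = "poly (tb \<alpha> n) z"
  let ?c = "poly (tc \<alpha> n) z" and ?d = "poly (td \<alpha> n) z"
  obtain x y where xy: "n > 0 \<longrightarrow> cmod y < x" "n = 0 \<longrightarrow> x = 0 \<and> y = 0"
     "2 * poly (crit_op n (ta \<alpha> n)) z = of_real x * ?a - cnj y * ?b"
     "2 * poly (crit_op n (tc \<alpha> n)) z = of_real x * ?c - cnj y * ?d"
     "2 * poly (crit_op n (tb \<alpha> n)) z = y * ?a - of_real x * ?b"
     "2 * poly (crit_op n (td \<alpha> n)) z = y * ?c - of_real x * ?d"
    using Suc by auto
  obtain w where rev: "?c = w * cnj ?b" "?d = w * cnj ?a" using tcol_reversal[OF assms(2)] by blast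
  have nrm: "(cmod ?a)\<^sup>2 = 1 + (cmod ?b)\<^sup>2" using tcol_norm Suc.prems assms(2) by simp
  \<comment> \<open>\<open>X\<close> and \<open>Y\<close> are the diagonal and upper right entries
    of T^* T for T = T_n, computed with |c| = |b| and |d| = |a|. They are the next summand of
    P.\<close>
  define X where "X = (cmod ?a)\<^sup>2 + (cmod ?b)\<^sup>2"
  define Y where "Y = 2 * cnj ?a * ?b"
  have aa: "?a * cnj ?a = 1 + ?b * cnj ?b"
    using nrm by (metis complex_norm_square of_real_1 of_real_add)
  have X: "of_real X = ?a * cnj ?a + ?b * cnj ?b"
    by (simp add: X_def flip: complex_norm_square)
  have "(cmod ?a - cmod ?b)\<^sup>2 > 0" using nrm by auto
  then have XY: "cmod Y < X"
    by (simp add: X_def Y_def norm_mult power2_diff)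
  note simps = X Y_def rev complex_cnj_mult complex_cnj_cnj complex_cnj_numeral
  \<comment> \<open>\<open>J1\<close> to \<open>J4\<close> are the entries of T J T^* T = J T, which
    holds because T J T^* = J on the circle.\<close>
  have J1: "of_real X * ?a - cnj Y * ?b = ?a" unfolding simps using aa by algebra
  have J2: "of_real X * ?c - cnj Y * ?d = - ?c" unfolding simps using aa by algebra
  have J3: "Y * ?a - of_real X * ?b = ?b" unfolding simps using aa by algebra
  have J4: "Y * ?c - of_real X * ?d = - ?d" unfolding simps using aa by algebra
  note J = J1 J2 J3 J4
  have split: "of_real (x + X) * u - cnj (y + Y) * v = (of_real x * u - cnj y * v) + (of_real X * u - cnj Y * v)"
    "(y + Y) * u - of_real (x + X) * v = (y * u - of_real x * v) + (Y * u - of_real X * v)" for u v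
    by (simp_all add: algebra_simps)
  have s: "2 * poly (crit_op n (ta \<alpha> n)) z + ?a = of_real (x + X) * ?a - cnj (y + Y) * ?b"
    "2 * poly (crit_op n (tc \<alpha> n)) z - ?c = of_real (x + X) * ?c - cnj (y + Y) * ?d"
    "2 * poly (crit_op n (tb \<alpha> n)) z + ?b = (y + Y) * ?a - of_real (x + X) * ?b"
    "2 * poly (crit_op n (td \<alpha> n)) z - ?d = (y + Y) * ?c - of_real (x + X) * ?d"
    unfolding split J xy(3-6) by simp_all
  have half: "2 * (k * (z * (U' + U / 2) - \<beta> * (V' - V / 2))) = k * (z * (2 * U' + U) - \<beta> * (2 * V' - V))"
    "2 * (k * (V' - V / 2 - \<beta> * (z * (U' + U / 2)))) = k * (2 * V' - V - \<beta> * (z * (2 * U' + U)))"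
    for k \<beta> U U' V V' by (simp_all add: algebra_simps)
  show ?case
  proof (intro exI conjI)
    show "0 < Suc n \<longrightarrow> cmod (y + Y) < x + X"
      using xy(1,2) XY norm_triangle_ineq[of y Y] by (cases "n = 0") auto
  qed (unfold crit_op_tcol_Suc half s poly_tcol_Suc, simp_all add: algebra_simps)
qed


text \<open>At a critical point T J P has trace zero, so x|a - d| is at most 2|y||b|. The
  parallelogram law and |a + d| \<le> 2 give |a - d| \<ge> 2|b|. As |y| < x, this forces b = 0, and
  |c| = |b|.\<close>

lemma critical_imp_closed_gap:
  assumes "\<forall>i<n. cmod (\<alpha> i) < 1" and "n > 0" and z: "cmod z = 1"
    and "poly (crit_op n (trace_poly n \<alpha>)) z = 0" and "cmod (poly (trace_poly n \<alpha>) z) \<le> 2"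
  shows "poly (tc \<alpha> n) z = 0"
proof -
  let ?a = "poly (ta \<alpha> n) z" and ?b = "poly (tb \<alpha> n) z"
  let ?c = "poly (tc \<alpha> n) z" and ?d = "poly (td \<alpha> n) z"
  obtain x y where xy: "cmod y < x"
     "2 * poly (crit_op n (ta \<alpha> n)) z = of_real x * ?a - cnj y * ?b"
     "2 * poly (crit_op n (td \<alpha> n)) z = y * ?c - of_real x * ?d"
    using crit_op_entries[OF assms(1) z] assms(2) by blast
  have cb: "cmod ?c = cmod ?b" and da: "cmod ?d = cmod ?a"
    using tcol_reversal[OF z, of \<alpha> n] z by (simp_all add: norm_mult norm_power)
  have nrm: "(cmod ?a)\<^sup>2 = 1 + (cmod ?b)\<^sup>2" using tcol_norm assms(1) z by blast
  have "2 * poly (crit_op n (trace_poly n \<alpha>)) z = of_real x * (?a - ?d) - (cnj y * ?b - y * ?c)"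
    unfolding trace_poly_def crit_op_add poly_add distrib_left xy by (simp add: algebra_simps)
  then have "of_real x * (?a - ?d) = cnj y * ?b - y * ?c" using assms(4) by simp
  then have "cmod (of_real x * (?a - ?d)) \<le> cmod (cnj y * ?b) + cmod (y * ?c)"
    by (metis norm_triangle_ineq4)
  then have le: "x * cmod (?a - ?d) \<le> 2 * cmod y * cmod ?b"
    using xy(1) norm_ge_zero[of y] cb by (simp add: norm_mult)
  have "(cmod (?a + ?d))\<^sup>2 + (cmod (?a - ?d))\<^sup>2 = 2 * (cmod ?a)\<^sup>2 + 2 * (cmod ?d)\<^sup>2"
    by (simp add: cmod_power2) (simp add: power2_eq_square algebra_simps)
  moreover have "(cmod (?a + ?d))\<^sup>2 \<le> 2\<^sup>2"
    using assms(5) by (intro power_mono) (auto simp: trace_poly_def)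
  ultimately have "(2 * cmod ?b)\<^sup>2 \<le> (cmod (?a - ?d))\<^sup>2"
    using nrm da by (simp add: power_mult_distrib)
  then have ge: "2 * cmod ?b \<le> cmod (?a - ?d)" by (rule power2_le_imp_le) simp
  have "?b = 0"
  proof (rule ccontr)
    assume "?b \<noteq> 0"
    then have "2 * cmod ?b * cmod y < 2 * cmod ?b * x" using xy(1) by simp
    also have "\<dots> \<le> cmod (?a - ?d) * x"
      using ge xy(1) norm_ge_zero[of y] by (intro mult_right_mono) linarith+
    finally show False using le by (simp add: mult_ac)
  qed
  then show ?thesis using cb by simp
qed

text \<open>Dividing by z^(n/2) brings the transfer matrix into SU(1,1), with rows (a, b) and
  (\<open>cnj b\<close>, \<open>cnj a\<close>). Its trace is real, and the trace of T J P becomes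
  purely imaginary.\<close>

lemma critical_value_purely_imaginary:
  assumes "\<forall>i<n. cmod (\<alpha> i) < 1" and "cmod z = 1" and "n = 2 * m"
  shows "Re (poly (crit_op n (trace_poly n \<alpha>)) z / z ^ m) = 0"
    "Im (poly (trace_poly n \<alpha>) z / z ^ m) = 0"
proof -
  let ?a = "poly (ta \<alpha> n) z" and ?b = "poly (tb \<alpha> n) z"
  let ?c = "poly (tc \<alpha> n) z" and ?d = "poly (td \<alpha> n) z"
  obtain x y where xy:
     "2 * poly (crit_op n (ta \<alpha> n)) z = of_real x * ?a - cnj y * ?b"
     "2 * poly (crit_op n (td \<alpha> n)) z = y * ?c - of_real x * ?d"
    using crit_op_entries[OF assms(1,2)] by blast
  define w where "w = z ^ m"
  have w: "w * cnj w = 1" "w \<noteq> 0"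
    using cnj_mult_self[of w] assms(2) by (auto simp: w_def norm_power)
  have zn: "z ^ n = w * w" by (simp add: w_def assms(3) mult_2 power_add)
  have div: "u / w = cnj w * u" for u using w by (simp add: field_simps)
  define a b where "a = ?a / w" and "b = ?b / w"
  have ab: "?a = w * a" "?b = w * b" using w by (simp_all add: a_def b_def)
  have cd: "?c = w * cnj b" "?d = w * cnj a"
    using tcol_reversal[OF assms(2), of \<alpha> n] w unfolding zn ab by (simp_all add: mult.assoc)
  have "2 * poly (crit_op n (trace_poly n \<alpha>)) z = w * (of_real x * (a - cnj a) - (cnj y * b - y * cnj b))"
    unfolding trace_poly_def crit_op_add poly_add distrib_left xy cd ab by (simp add: algebra_simps)
  moreover define X where "X = poly (crit_op n (trace_poly n \<alpha>)) z / w"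
  ultimately have "w * (2 * X) = w * (of_real x * (a - cnj a) - (cnj y * b - y * cnj b))"
    using w(2) by simp
  then have "2 * X = of_real x * (a - cnj a) - (cnj y * b - y * cnj b)"
    using w(2) mult_left_cancel by blast
  then have "Re (2 * X) = 0" by simp
  then have "Re X = 0" by simp
  then show "Re (poly (crit_op n (trace_poly n \<alpha>)) z / z ^ m) = 0" by (simp add: X_def w_def)
  have "poly (trace_poly n \<alpha>) z / w = a + cnj a"
    using w unfolding trace_poly_def poly_add cd ab by (simp add: field_simps)
  then show "Im (poly (trace_poly n \<alpha>) z / z ^ m) = 0" unfolding w_def by simp
qed

subsection \<open>The discriminant along the circle\<close>

lemma cis_Arg_unit: "cmod z = 1 \<Longrightarrow> cis (Arg z) = z"
  by (metis cis_rcis_eq rcis_cmod_Arg)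

text \<open>The line through \<open>cis s\<close> and \<open>cis t\<close> meets the circle in these
  two points only and separates the two arcs, so a connected subset of the circle that misses both
  points stays on one side.\<close>

lemma circle_connected_separation:
  assumes "s < t" and "connected C" "C \<subseteq> sphere 0 1"
    and "cis s \<notin> C" "cis t \<notin> C" and "s < a" "a < t" "cis a \<in> C" and "t < b" "b < s + 2 * pi"
  shows "cis b \<notin> C"
proof
  assume "cis b \<in> C"
  define h where "h = (t - s) / 2"
  \<comment> \<open>the affine function vanishing on the line through \<open>cis s\<close> and \<open>cis t\<close>\<close>
  define l where "l z = Re (z * cis (- ((s + t) / 2))) - cos h" for z
  have h: "0 < h" "h < pi" using assms by (auto simp: h_def)
  have l_cis: "l (cis \<theta>) = cos (\<theta> - (s + t) / 2) - cos h" for \<theta>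
    by (simp add: l_def cis_mult)
  have "cos h < cos \<bar>a - (s + t) / 2\<bar>"
  proof (rule cos_monotone_0_pi)
    show "\<bar>a - (s + t) / 2\<bar> < h" using assms by (simp add: h_def abs_less_iff field_simps)
  qed (use h in auto)
  then have la: "l (cis a) > 0" unfolding l_cis cos_abs_real by simp
  define x where "x = b - (s + t) / 2"
  have x: "h < x" "x < 2 * pi - h" using assms by (simp_all add: x_def h_def field_simps)
  have "cos x < cos h"
  proof (cases "x \<le> pi")
    case True
    then show ?thesis using h x by (intro cos_monotone_0_pi) auto
  next
    case False
    have "cos (2 * pi - x) < cos h" using False h x by (intro cos_monotone_0_pi) auto
    then show ?thesis by simp
  qed
  then have lb: "l (cis b) < 0" unfolding l_cis x_def by simp
  have "continuous_on C l" unfolding l_def by (intro continuous_intros)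
  then have "connected (l ` C)" using assms(2) by (rule connected_continuous_image)
  then have "0 \<in> l ` C"
    by (rule connectedD_interval[of _ "l (cis b)" "l (cis a)"])
      (use la lb \<open>cis a \<in> C\<close> \<open>cis b \<in> C\<close> in \<open>auto intro: less_imp_le\<close>)
  then obtain z where z: "z \<in> C" "l z = 0" by auto
  define y where "y = Arg (z * cis (- ((s + t) / 2)))"
  have "cmod z = 1" using z assms(3) by auto
  then have y: "cis y = z * cis (- ((s + t) / 2))"
    unfolding y_def by (intro cis_Arg_unit) (simp add: norm_mult)
  have "z = cis y * cis ((s + t) / 2)"
    unfolding y by (simp add: mult.assoc cis_mult)
  then have zy: "z = cis (y + (s + t) / 2)" by (simp add: cis_mult)
  have "l (cis (y + (s + t) / 2)) = 0" using z(2) by (simp only: zy)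
  then have "cos y = cos h" unfolding l_cis by simp
  then have "cos \<bar>y\<bar> = cos h" by simp
  moreover have "\<bar>y\<bar> \<le> pi"
    using Arg_le_pi[of "z * cis (- ((s + t) / 2))"] mpi_less_Arg[of "z * cis (- ((s + t) / 2))"]
    unfolding y_def[symmetric] by linarith
  ultimately have "\<bar>y\<bar> = h" using h by (auto intro!: cos_inj_pi[of "\<bar>y\<bar>" h])
  then have "y = (t - s) / 2 \<or> y = - ((t - s) / 2)" unfolding h_def by linarith
  then have "y + (s + t) / 2 = t \<or> y + (s + t) / 2 = s" by argo
  then have "z = cis t \<or> z = cis s" using zy by metis
  then show False using z(1) assms(4,5) by metis
qed

text \<open>For fixed angles this consists of finitely many strict inequalities on the discriminant,
  hence is stable under perturbation of \<alpha>. That is why \<open>u i\<close> is asked to lie in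
  the interior of a band rather than at a zero.\<close>

definition alternating :: "nat \<Rightarrow> (nat \<Rightarrow> complex) \<Rightarrow> (nat \<Rightarrow> real) \<Rightarrow> (nat \<Rightarrow> real) \<Rightarrow> bool" where
  "alternating p \<alpha> u w \<longleftrightarrow> (\<forall>i<p. u i < w i \<and> w i < u (Suc i)) \<and> u p = u 0 + 2 * pi \<and>
    (\<forall>i<p. cmod (discriminant p \<alpha> (cis (u i))) < 2 \<and> cmod (discriminant p \<alpha> (cis (w i))) > 2)"

section \<open>Counting the open gaps\<close>

locale even_period =
  fixes p m :: nat and \<alpha> :: "nat \<Rightarrow> complex"
  assumes p_eq: "p = 2 * m" and m_pos: "m > 0" and in_disk: "\<forall>i<p. cmod (\<alpha> i) < 1"
begin

lemma p_pos: "p > 0" using p_eq m_pos by simp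

abbreviation Q where "Q \<equiv> trace_poly p \<alpha>"
abbreviation K where "K \<equiv> crit_op p Q"

text \<open>The quotient is real on the circle, so \<open>Re\<close> only changes the type and
  Rolle's theorem becomes available.\<close>

definition disc_angle :: "real \<Rightarrow> real" where
  "disc_angle \<theta> = Re (poly Q (cis \<theta>) / cis \<theta> ^ m)"

lemma discriminant_norm:
  assumes "cmod z = 1"
  shows "cmod (discriminant p \<alpha> z) = cmod (poly Q z)"
  using assms by (simp add: discriminant_trace_poly norm_mult norm_power_int)

lemma open_gaps_eq: "open_gaps p \<alpha> = components {z \<in> sphere 0 1. cmod (poly Q z) > 2}"
proof -
  have "{z \<in> sphere 0 1. cmod (discriminant p \<alpha> z) > 2} = {z \<in> sphere 0 1. cmod (poly Q z) > 2}"
    using discriminant_norm by auto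
  then show ?thesis by (simp add: open_gaps_def)
qed

lemma abs_disc_angle: "\<bar>disc_angle \<theta>\<bar> = cmod (poly Q (cis \<theta>))"
proof -
  have "Im (poly Q (cis \<theta>) / cis \<theta> ^ m) = 0"
    by (rule critical_value_purely_imaginary(2)[OF in_disk norm_cis p_eq])
  then have "cmod (poly Q (cis \<theta>) / cis \<theta> ^ m) = \<bar>disc_angle \<theta>\<bar>"
    unfolding disc_angle_def by (rule cmod_eq_Re)
  then show ?thesis by (simp only: norm_divide norm_power norm_cis power_one div_by_1)
qed

lemma disc_angle_deriv:
  "(disc_angle has_real_derivative - Im (poly K (cis \<theta>) / cis \<theta> ^ m)) (at \<theta>)"
proof -
  let ?z = "cis \<theta>"
  define D where "D = (poly (pderiv Q) ?z * ?z ^ m - poly Q ?z * (of_nat m * ?z ^ (m - 1))) / (?z ^ m * ?z ^ m)"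
  have "((\<lambda>z. z ^ m) has_field_derivative of_nat m * ?z ^ (m - 1)) (at ?z)"
    by (auto intro!: derivative_eq_intros)
  then have "((\<lambda>z. poly Q z / z ^ m) has_field_derivative D) (at ?z)"
    unfolding D_def by (intro DERIV_divide poly_DERIV) auto
  moreover have "(cis has_vector_derivative \<i> * ?z) (at \<theta>)"
    unfolding has_vector_derivative_def by (auto intro!: derivative_eq_intros)
  ultimately have "((\<lambda>z. poly Q z / z ^ m) \<circ> cis has_vector_derivative \<i> * ?z * D) (at \<theta>)"
    by (intro field_vector_diff_chain_at)
  then have "((\<lambda>\<theta>. Re (((\<lambda>z. poly Q z / z ^ m) \<circ> cis) \<theta>)) has_vector_derivative Re (\<i> * ?z * D)) (at \<theta>)"
    by (rule bounded_linear.has_vector_derivative[OF bounded_linear_Re])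
  moreover have "\<i> * ?z * D = \<i> * (poly K ?z / ?z ^ m)"
  proof -
    obtain k where k: "m = Suc k" using m_pos gr0_implies_Suc by blast
    have "poly K ?z = ?z * poly (pderiv Q) ?z - of_nat m * poly Q ?z"
      by (simp add: crit_op_def p_eq)
    moreover have "z * ((a * (z * w) - b * (c * w)) / (z * w * (z * w))) = (z * a - c * b) / (z * w)"
      if "z \<noteq> 0" "w \<noteq> 0" for z w a b c :: complex
      using that by (simp add: field_simps)
    from this[of ?z "?z ^ k" "poly (pderiv Q) ?z" "poly Q ?z" "of_nat m"]
    have "?z * D = (?z * poly (pderiv Q) ?z - of_nat m * poly Q ?z) / ?z ^ m"
      by (simp only: D_def k power_Suc diff_Suc_1 cis_neq_zero power_not_zero not_False_eq_True simp_thms)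
    ultimately show ?thesis by (simp only: mult.assoc)
  qed
  moreover have "Re (\<i> * X) = - Im X" for X by simp
  ultimately show ?thesis
    by (simp only: has_real_derivative_iff_has_vector_derivative disc_angle_def[abs_def] o_def)
qed

text \<open>The derivative sees only the imaginary part of K/z^m, but the real part vanishes on the
  whole circle.\<close>

lemma critical_angle:
  assumes "(disc_angle has_real_derivative 0) (at \<theta>)"
  shows "poly K (cis \<theta>) = 0"
proof -
  have "Im (poly K (cis \<theta>) / cis \<theta> ^ m) = 0"
    using DERIV_unique[OF assms disc_angle_deriv] by simp
  moreover have "Re (poly K (cis \<theta>) / cis \<theta> ^ m) = 0"
    by (rule critical_value_purely_imaginary(1)[OF in_disk norm_cis p_eq])
  ultimately have "poly K (cis \<theta>) / cis \<theta> ^ m = 0" by (simp only: complex_eq_iff zero_complex.simps)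
  then show ?thesis by simp
qed

lemma finite_critical: "finite {z. poly K z = 0}" "card {z. poly K z = 0} \<le> p"
  using crit_op_trace_poly[OF in_disk p_pos] card_poly_roots_bound[of K] poly_roots_finite[of K] by auto

text \<open>The modulus has a maximum on the closure of the gap. It exceeds 2 there, so by
  maximality of components the maximizer and a whole arc around it lie in the gap.\<close>

lemma open_gap_contains_critical:
  assumes "C \<in> open_gaps p \<alpha>"
  shows "\<exists>z\<in>C. poly K z = 0"
proof -
  define S where "S = {z \<in> sphere 0 1. cmod (poly Q z) > 2}"
  have C: "C \<in> components S" using assms by (simp add: open_gaps_eq S_def)
  then have CS: "C \<subseteq> S" "C \<noteq> {}" "connected C"
    using in_components_subset in_components_nonempty in_components_connected by auto
  have "C \<subseteq> sphere 0 1" using CS by (auto simp: S_def)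
  then have cl: "closure C \<subseteq> sphere 0 1" by (simp add: closure_minimal)
  then have "compact (closure C)"
    using compact_Int_closed[OF compact_sphere closed_closure, of 0 1 C] by (simp add: Int_absorb1)
  moreover have "continuous_on (closure C) (\<lambda>z. cmod (poly Q z))" by (intro continuous_intros)
  moreover have "closure C \<noteq> {}" using CS by simp
  ultimately have "\<exists>z0\<in>closure C. \<forall>z\<in>closure C. cmod (poly Q z) \<le> cmod (poly Q z0)"
    by (intro continuous_attains_sup)
  then obtain z0 where z0: "z0 \<in> closure C"
    "\<And>z. z \<in> closure C \<Longrightarrow> cmod (poly Q z) \<le> cmod (poly Q z0)"
    by blast
  obtain c where "c \<in> C" using CS by auto
  then have "cmod (poly Q z0) > 2" using z0(2)[of c] CS closure_subset by (fastforce simp: S_def)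
  then have z0S: "z0 \<in> S" using z0 cl by (auto simp: S_def)
  have "connected (insert z0 C)"
    using z0 closure_subset[of C] by - (rule connected_intermediate_closure[OF CS(3)]; auto)
  then have "insert z0 C \<subseteq> C"
    using z0S CS(1,2)
    by - (rule components_maximal[OF C]; auto)
  then have z0C: "z0 \<in> C" by auto
  define \<theta>0 where "\<theta>0 = Arg z0"
  have z0eq: "cis \<theta>0 = z0"
    using z0S by (simp add: \<theta>0_def S_def cis_Arg_unit)
  have "open ((\<lambda>\<theta>. cmod (poly Q (cis \<theta>))) -` {2<..})"
    by (intro open_vimage continuous_intros)
  moreover have "\<theta>0 \<in> (\<lambda>\<theta>. cmod (poly Q (cis \<theta>))) -` {2<..}"
    using z0S by (simp add: z0eq S_def)
  ultimately obtain d where d: "d > 0" "ball \<theta>0 d \<subseteq> (\<lambda>\<theta>. cmod (poly Q (cis \<theta>))) -` {2<..}"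
    by (meson open_contains_ball)
  have "connected (cis ` ball \<theta>0 d)"
    by (intro connected_continuous_image continuous_intros) auto
  moreover have "cis ` ball \<theta>0 d \<subseteq> S" using d by (auto simp: S_def)
  moreover have "z0 \<in> cis ` ball \<theta>0 d" using d(1) z0eq by (auto intro!: image_eqI[of _ _ \<theta>0])
  ultimately have sub: "cis ` ball \<theta>0 d \<subseteq> C"
    using z0C by - (rule components_maximal[OF C]; auto)
  \<comment> \<open>Squaring replaces the absolute value by a differentiable function; its
    derivative vanishes only where that of \<open>disc_angle\<close> does, since the value is
    nonzero.\<close>
  have max: "\<forall>\<theta>. \<bar>\<theta>0 - \<theta>\<bar> < d \<longrightarrow> (disc_angle \<theta>)\<^sup>2 \<le> (disc_angle \<theta>0)\<^sup>2"
  proof (intro allI impI)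
    fix \<theta> assume "\<bar>\<theta>0 - \<theta>\<bar> < d"
    then have "cis \<theta> \<in> C" using sub by (auto simp: dist_real_def)
    then have "cmod (poly Q (cis \<theta>)) \<le> cmod (poly Q (cis \<theta>0))"
      unfolding z0eq using z0(2) closure_subset by blast
    then have "\<bar>disc_angle \<theta>\<bar> \<le> \<bar>disc_angle \<theta>0\<bar>" by (simp only: abs_disc_angle)
    then show "(disc_angle \<theta>)\<^sup>2 \<le> (disc_angle \<theta>0)\<^sup>2" by (simp only: abs_le_square_iff)
  qed
  obtain D where D: "(disc_angle has_real_derivative D) (at \<theta>0)" using disc_angle_deriv by blast
  have "((\<lambda>\<theta>. (disc_angle \<theta>)\<^sup>2) has_real_derivative 2 * disc_angle \<theta>0 * D) (at \<theta>0)"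
    by (auto intro!: derivative_eq_intros D)
  from DERIV_local_max[OF this d(1) max] have "2 * disc_angle \<theta>0 * D = 0" .
  moreover have "\<bar>disc_angle \<theta>0\<bar> > 2"
    unfolding abs_disc_angle z0eq using z0S by (simp add: S_def)
  ultimately have "(disc_angle has_real_derivative 0) (at \<theta>0)"
    using D by auto
  then show ?thesis using critical_angle z0eq z0C by auto
qed

text \<open>Disjoint gaps contain distinct critical points, at most p in number. With p gaps these
  points exhaust the roots of \<open>K\<close>, so every root lies in a gap.\<close>

lemma open_gaps_upper_bound:
  "finite (open_gaps p \<alpha>)" "card (open_gaps p \<alpha>) \<le> p"
  "card (open_gaps p \<alpha>) = p \<Longrightarrow> poly K z = 0 \<Longrightarrow> cmod (poly Q z) > 2"
proof -
  obtain f where f: "\<And>C. C \<in> open_gaps p \<alpha> \<Longrightarrow> f C \<in> C \<and> poly K (f C) = 0"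
    using open_gap_contains_critical by metis
  have inj: "inj_on f (open_gaps p \<alpha>)"
  proof (rule inj_onI)
    fix C D assume CD: "C \<in> open_gaps p \<alpha>" "D \<in> open_gaps p \<alpha>" "f C = f D"
    then have "f C \<in> C \<inter> D" using f[OF CD(1)] f[OF CD(2)] by simp
    then show "C = D" using components_eq[OF CD(1,2)[unfolded open_gaps_def]] by blast
  qed
  have sub: "f ` open_gaps p \<alpha> \<subseteq> {z. poly K z = 0}" using f by blast
  show fin: "finite (open_gaps p \<alpha>)"
    using inj_on_finite[OF inj sub finite_critical(1)] .
  show "card (open_gaps p \<alpha>) \<le> p"
    using finite_critical(2) card_inj_on_le[OF inj sub finite_critical(1)] by linarith
  assume "card (open_gaps p \<alpha>) = p" "poly K z = 0"
  then have "f ` open_gaps p \<alpha> = {z. poly K z = 0}"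
    using finite_critical(2) card_image[OF inj] by (intro card_seteq[OF finite_critical(1) sub]) simp
  then obtain C where C: "C \<in> open_gaps p \<alpha>" "z = f C" using \<open>poly K z = 0\<close> by blast
  then have "z \<in> C" using f by blast
  moreover have "C \<subseteq> {z \<in> sphere 0 1. cmod (poly Q z) > 2}"
    using C(1) unfolding open_gaps_eq by (rule in_components_subset)
  ultimately show "cmod (poly Q z) > 2" by blast
qed

text \<open>A double zero would be a critical point on the circle where the trace vanishes, against
  the assumption. So \<open>Q\<close> is squarefree of degree p.\<close>

lemma card_trace_poly_roots:
  assumes "\<And>z. cmod z = 1 \<Longrightarrow> poly K z = 0 \<Longrightarrow> cmod (poly Q z) > 2"
  shows "card {z. poly Q z = 0} = p"
proof -
  have "rsquarefree Q"
    unfolding rsquarefree_roots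
  proof (intro allI notI)
    fix z assume z: "poly Q z = 0 \<and> poly (pderiv Q) z = 0"
    then have "poly K z = 0" by (simp add: crit_op_def)
    then show False
      using z assms[of z] trace_poly_roots_in_sphere[OF in_disk p_pos, of z] by simp
  qed
  then have "Q = smult (lead_coeff Q) (\<Prod>z|poly Q z = 0. [:-z, 1:])"
    by (simp add: complex_poly_decompose_rsquarefree)
  moreover have "lead_coeff Q \<noteq> 0" using coeff_trace_poly[OF in_disk p_pos] by simp
  ultimately have "degree Q = degree (\<Prod>z|poly Q z = 0. [:-z, 1:])"
    by (metis degree_smult_eq)
  also have "\<dots> = card {z. poly Q z = 0}"
    by (subst degree_prod_eq_sum_degree) auto
  finally show ?thesis using coeff_trace_poly[OF in_disk p_pos] by simp
qed

lemma alternating_if_no_closed_gap: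
  assumes nb: "\<And>z. cmod z = 1 \<Longrightarrow> poly K z = 0 \<Longrightarrow> cmod (poly Q z) > 2"
  shows "\<exists>u w. alternating p \<alpha> u w"
proof -
  define Z where "Z = {z. poly Q z = 0}"
  have cardZ: "card Z = p" unfolding Z_def using nb by (rule card_trace_poly_roots)
  have cis_Z: "cis (Arg z) = z" if "z \<in> Z" for z
    using that trace_poly_roots_in_sphere[OF in_disk p_pos] by (auto simp: Z_def intro: cis_Arg_unit)
  define l where "l = sorted_list_of_set (Arg ` Z)"
  have finZ: "finite (Arg ` Z)" using cardZ p_pos card_ge_0_finite by auto
  have "card (Arg ` Z) = p" using cis_Z cardZ by (metis card_image inj_on_inverseI)
  then have len: "length l = p" by (simp add: l_def)
  have setl: "set l = Arg ` Z" using finZ by (simp add: l_def)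
  have lt: "l ! i < l ! j" if "i < j" "j < p" for i j
    using that len sorted_wrt_nth_less[OF strict_sorted_list_of_set, of i j "Arg ` Z"] by (simp add: l_def)
  have l: "l ! i \<in> {-pi<..pi}" "poly Q (cis (l ! i)) = 0" if "i < p" for i
  proof -
    have "l ! i \<in> Arg ` Z" using that len setl nth_mem by metis
    then show "l ! i \<in> {-pi<..pi}" "poly Q (cis (l ! i)) = 0"
      using cis_Z mpi_less_Arg Arg_le_pi by (auto simp: Z_def)
  qed
  \<comment> \<open>Index p repeats the first zero after a full turn and so closes the
    cycle.\<close>
  define u where "u i = (if i < p then l ! i else l ! 0 + 2 * pi)" for i
  have cis_per: "cis (x + 2 * pi) = cis x" for x by (simp flip: cis_mult)
  have u0: "poly Q (cis (u i)) = 0" for i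
    using l p_pos by (auto simp: u_def cis_per)
  then have du: "disc_angle (u i) = 0" for i by (simp add: disc_angle_def)
  have u_less: "u i < u (Suc i)" if "i < p" for i
    using that lt[of i "Suc i"] l(1)[of i] l(1)[of 0] p_pos by (auto simp: u_def)
  have "\<exists>x. u i < x \<and> x < u (Suc i) \<and> cmod (poly Q (cis x)) > 2" if "i < p" for i
  proof -
    have "\<exists>x. u i < x \<and> x < u (Suc i) \<and> (disc_angle has_real_derivative 0) (at x)"
    proof (rule Rolle)
      show "continuous_on {u i..u (Suc i)} disc_angle"
        using disc_angle_deriv DERIV_isCont by (intro continuous_at_imp_continuous_on) blast
      show "disc_angle differentiable (at x)" for x
        using disc_angle_deriv real_differentiable_def by blast
    qed (use u_less[OF that] du in auto)
    then obtain x where x: "u i < x" "x < u (Suc i)" "(disc_angle has_real_derivative 0) (at x)" by blast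
    have "cmod (poly Q (cis x)) > 2" by (rule nb[OF norm_cis critical_angle[OF x(3)]])
    then show ?thesis using x by blast
  qed
  then obtain w where "\<And>i. i < p \<Longrightarrow> u i < w i \<and> w i < u (Suc i) \<and> cmod (poly Q (cis (w i))) > 2"
    by metis
  then have "alternating p \<alpha> u w"
    using u0 p_pos by (auto simp: alternating_def discriminant_norm) (auto simp: u_def)
  then show ?thesis by blast
qed

text \<open>For i < j the points at angles \<open>u 0\<close> and \<open>u j\<close> cut the circle
  so that \<open>w i\<close> and \<open>w j\<close> lie on different arcs, hence in different
  components.\<close>

lemma alternating_imp_all_gaps_open:
  assumes "alternating p \<alpha> u w"
  shows "card (open_gaps p \<alpha>) = p"
proof -
  define S where "S = {z \<in> sphere 0 1. cmod (discriminant p \<alpha> z) > 2}"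
  have uw: "u i < w i" "w i < u (Suc i)" "cis (u i) \<notin> S" "cis (w i) \<in> S" if "i < p" for i
    using assms that by (auto simp: alternating_def S_def)
  have up: "u p = u 0 + 2 * pi" using assms by (simp add: alternating_def)
  have mono: "u i \<le> u j" if "i \<le> j" "j \<le> p" for i j
    using that
  proof (induction j rule: dec_induct)
    case (step k)
    then show ?case using uw(1,2)[of k] by simp
  qed simp
  define f where "f i = connected_component_set S (cis (w i))" for i
  have "f i \<noteq> f j" if ij: "i < j" "j < p" for i j
  proof
    assume eq: "f i = f j"
    have "f i \<subseteq> S" unfolding f_def by (rule connected_component_subset)
    moreover have "cis (w i) \<in> f i" using uw(4)[of i] ij by (simp add: f_def)
    moreover have "cis (w j) \<in> f i" unfolding eq using uw(4)[of j] ij by (simp add: f_def)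
    moreover have "u 0 < u j" "w i < u j" "u 0 < w i" "u j < w j" "w j < u 0 + 2 * pi"
      using mono[of 0 i] mono[of "Suc i" j] mono[of "Suc j" p] uw(1,2)[of i] uw(1,2)[of j] ij up by auto
    moreover have "connected (f i)" by (simp add: f_def)
    moreover have "f i \<subseteq> sphere 0 1" using \<open>f i \<subseteq> S\<close> by (auto simp: S_def)
    ultimately show False
      using circle_connected_separation[of "u 0" "u j" "f i" "w i" "w j"] uw(3)[of 0] uw(3)[of j] ij p_pos
      by blast
  qed
  then have "inj_on f {..<p}" by (metis inj_onI lessThan_iff linorder_neqE_nat)
  moreover have "f ` {..<p} \<subseteq> open_gaps p \<alpha>"
    unfolding open_gaps_def S_def[symmetric] components_def f_def using uw(4) by blast
  ultimately have "p \<le> card (open_gaps p \<alpha>)"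
    using card_inj_on_le[of f "{..<p}"] open_gaps_upper_bound(1) by auto
  then show ?thesis using open_gaps_upper_bound(2) by linarith
qed

lemma all_gaps_open_iff_alternating: "all_gaps_open p \<alpha> \<longleftrightarrow> (\<exists>u w. alternating p \<alpha> u w)"
  unfolding all_gaps_open_def
  using alternating_if_no_closed_gap alternating_imp_all_gaps_open open_gaps_upper_bound(3) by blast

text \<open>The sufficient condition used for density: it involves a single entry, which is affine
  in the last parameter up to the factor 1/\<open>rho\<close>.\<close>

lemma all_gaps_open_if_no_closed_gap:
  assumes "\<And>z. cmod z = 1 \<Longrightarrow> poly (tc \<alpha> p) z \<noteq> 0"
  shows "all_gaps_open p \<alpha>"
  unfolding all_gaps_open_iff_alternating
  using assms critical_imp_closed_gap[OF in_disk p_pos]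
  by (intro alternating_if_no_closed_gap) (meson linorder_not_le)

end

subsection \<open>Openness and density in the polydisk\<close>

lemma topspace_polydisk: "topspace (polydisk p) = PiE {..<p} (\<lambda>_. ball 0 1)"
  by (simp add: polydisk_def)

lemma even_period_polydisk:
  assumes "even p" "p > 0" "\<alpha> \<in> topspace (polydisk p)"
  shows "even_period p (p div 2) \<alpha>"
  using assms by unfold_locales (auto simp: topspace_polydisk PiE_iff)

text \<open>The recursion couples both components, so they are treated together. Continuity is
  expressed by limits because the division needs \<open>rho\<close> nonzero at the limit
  point.\<close>

lemma continuous_map_tcol:
  assumes "n \<le> p"
  shows "continuous_map (polydisk p) euclidean (\<lambda>\<alpha>. poly (tcol_fst \<alpha> u v n) z)
    \<and> continuous_map (polydisk p) euclidean (\<lambda>\<alpha>. poly (tcol_snd \<alpha> u v n) z)"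
  using assms
proof (induction n)
  case (Suc n)
  have proj: "continuous_map (polydisk p) (top_of_set (ball 0 1)) (\<lambda>\<alpha>. \<alpha> n)"
    unfolding polydisk_def using Suc.prems by (intro continuous_map_product_projection) simp
  have "((\<lambda>\<beta>. poly (tcol_fst \<beta> u v (Suc n)) z) \<longlongrightarrow> poly (tcol_fst \<alpha> u v (Suc n)) z) (atin (polydisk p) \<alpha>)
      \<and> ((\<lambda>\<beta>. poly (tcol_snd \<beta> u v (Suc n)) z) \<longlongrightarrow> poly (tcol_snd \<alpha> u v (Suc n)) z) (atin (polydisk p) \<alpha>)"
    if \<alpha>: "\<alpha> \<in> topspace (polydisk p)" for \<alpha>
  proof -
    have "\<alpha> n \<in> ball 0 1" using \<alpha> Suc.prems by (auto simp: topspace_polydisk PiE_iff)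
    then have "rho (\<alpha> n) \<noteq> 0" using rho_sq(1)[of "\<alpha> n"] by auto
    moreover have lim: "((\<lambda>\<beta>. \<beta> n) \<longlongrightarrow> \<alpha> n) (atin (polydisk p) \<alpha>)"
      using proj \<alpha> by (simp add: continuous_map_atin)
    moreover have "((\<lambda>\<beta>. rho (\<beta> n)) \<longlongrightarrow> rho (\<alpha> n)) (atin (polydisk p) \<alpha>)"
      unfolding rho_def by (intro tendsto_intros lim)
    moreover have "((\<lambda>\<beta>. poly (tcol_fst \<beta> u v n) z) \<longlongrightarrow> poly (tcol_fst \<alpha> u v n) z) (atin (polydisk p) \<alpha>)"
      "((\<lambda>\<beta>. poly (tcol_snd \<beta> u v n) z) \<longlongrightarrow> poly (tcol_snd \<alpha> u v n) z) (atin (polydisk p) \<alpha>)"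
      using Suc \<alpha> by (simp_all add: continuous_map_atin)
    ultimately show ?thesis unfolding poly_tcol_Suc by (intro conjI tendsto_intros)
  qed
  then show ?case by (simp add: continuous_map_atin)
qed simp

lemma continuous_map_norm_discriminant:
  "continuous_map (polydisk p) euclideanreal (\<lambda>\<alpha>. cmod (discriminant p \<alpha> z))"
proof -
  have "continuous_map (polydisk p) euclidean (\<lambda>\<alpha>. poly (trace_poly p \<alpha>) z)"
    unfolding trace_poly_def poly_add using continuous_map_tcol[of p p]
    by (intro continuous_map_add) auto
  then have "continuous_map (polydisk p) euclideanreal (\<lambda>\<alpha>. cmod (poly (trace_poly p \<alpha>) z))"
    by (rule continuous_map_norm)
  then show ?thesis
    unfolding discriminant_trace_poly norm_mult by (intro continuous_map_real_mult) auto
qed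

lemma openin_alternating: "openin (polydisk p) {\<alpha> \<in> topspace (polydisk p). alternating p \<alpha> u w}"
proof -
  let ?N = "\<lambda>z \<alpha>. cmod (discriminant p \<alpha> z)"
  have lt: "openin (polydisk p) {\<alpha> \<in> topspace (polydisk p). ?N z \<alpha> \<in> {..<2}}"
    and gt: "openin (polydisk p) {\<alpha> \<in> topspace (polydisk p). ?N z \<alpha> \<in> {2<..}}" for z
    by (rule openin_continuous_map_preimage[OF continuous_map_norm_discriminant]; simp)+
  \<comment> \<open>The conditions on the angles do not involve \<alpha>; if they fail, the set is
    empty.\<close>
  have eq: "{\<alpha> \<in> topspace (polydisk p). alternating p \<alpha> u w} =
      (if (\<forall>i<p. u i < w i \<and> w i < u (Suc i)) \<and> u p = u 0 + 2 * pi
       then topspace (polydisk p) \<inter> (\<Inter>i\<in>{..<p}. {\<alpha> \<in> topspace (polydisk p). ?N (cis (u i)) \<alpha> \<in> {..<2}}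
         \<inter> {\<alpha> \<in> topspace (polydisk p). ?N (cis (w i)) \<alpha> \<in> {2<..}}) else {})"
    by (auto simp: alternating_def)
  show ?thesis
    unfolding eq using openin_INT[OF finite_lessThan, of p "polydisk p", OF openin_Int[OF lt gt]]
    by (simp add: Int_commute)
qed

theorem theorem5p3:
  fixes p :: nat
  assumes "even p" and "p > 0"
  shows "openin (polydisk p) {\<alpha> \<in> topspace (polydisk p). all_gaps_open p \<alpha>}
    \<and> polydisk p closure_of {\<alpha> \<in> topspace (polydisk p). all_gaps_open p \<alpha>} = topspace (polydisk p)"
proof
  let ?G = "{\<alpha> \<in> topspace (polydisk p). all_gaps_open p \<alpha>}"
  note period = even_period_polydisk[OF assms]
  have "?G = (\<Union>u. \<Union>w. {\<alpha> \<in> topspace (polydisk p). alternating p \<alpha> u w})"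
    using even_period.all_gaps_open_iff_alternating[OF period] by auto
  moreover have "openin (polydisk p) (\<Union>u. \<Union>w. {\<alpha> \<in> topspace (polydisk p). alternating p \<alpha> u w})"
    by (intro openin_Union ballI; clarsimp)
      (intro openin_Union ballI; use openin_alternating in clarsimp)
  ultimately show "openin (polydisk p) ?G" by simp
  show "polydisk p closure_of ?G = topspace (polydisk p)"
    unfolding dense_intersects_open
  proof (intro allI impI)
    fix T assume T: "openin (polydisk p) T \<and> T \<noteq> {}"
    then obtain \<alpha> where \<alpha>: "\<alpha> \<in> T" by auto
    then have \<alpha>_top: "\<alpha> \<in> topspace (polydisk p)" using T openin_subset by blast
    obtain n where n: "p = Suc n" using assms(2) gr0_implies_Suc by blast
    define \<phi> where "\<phi> \<beta> = \<alpha>(n := \<beta>)" for \<beta>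
    have cont: "continuous_map (top_of_set (ball 0 1)) (polydisk p) \<phi>"
      unfolding polydisk_def continuous_map_componentwise
    proof (intro conjI ballI)
      show "\<phi> ` topspace (top_of_set (ball 0 1)) \<subseteq> extensional {..<p}"
        using \<alpha>_top n by (auto simp: \<phi>_def topspace_polydisk PiE_iff extensional_def)
      show "continuous_map (top_of_set (ball 0 1)) (top_of_set (ball 0 1)) (\<lambda>\<beta>. \<phi> \<beta> k)"
        if "k \<in> {..<p}" for k
        using that \<alpha>_top
        by (cases "k = n") (auto simp: \<phi>_def topspace_polydisk PiE_iff continuous_map_in_subtopology)
    qed
    \<comment> \<open>The slice of \<open>T\<close> in the direction of the last parameter: a
      nonempty open set, hence not negligible.\<close>
    define V where "V = {\<beta> \<in> ball 0 1. \<phi> \<beta> \<in> T}"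
    have "openin (top_of_set (ball 0 1)) V"
      using openin_continuous_map_preimage[OF cont, of T] T by (simp add: V_def)
    then have "open V" by (simp add: openin_open_eq)
    moreover have "\<alpha> n \<in> V"
      using \<alpha> \<alpha>_top n by (auto simp: V_def \<phi>_def topspace_polydisk PiE_iff)
    ultimately have V: "\<not> negligible V" using open_not_negligible by blast
    \<comment> \<open>Solving c - \<beta> z a = 0 for \<beta>: the only value of the last parameter
      for which the lower left entry of T_p vanishes at \<open>cis \<theta>\<close>.\<close>
    define \<gamma> where "\<gamma> \<theta> = poly (tc \<alpha> n) (cis \<theta>) / (cis \<theta> * poly (ta \<alpha> n) (cis \<theta>))" for \<theta>
    have disk: "\<forall>i<n. cmod (\<alpha> i) < 1" using \<alpha>_top n by (auto simp: topspace_polydisk PiE_iff)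
    have ta_nz: "poly (ta \<alpha> n) (cis \<theta>) \<noteq> 0" for \<theta>
    proof
      assume "poly (ta \<alpha> n) (cis \<theta>) = 0"
      then have "1 + (cmod (poly (tb \<alpha> n) (cis \<theta>)))\<^sup>2 = 0" using tcol_norm[OF disk, of "cis \<theta>"] by simp
      then show False using zero_le_power2[of "cmod (poly (tb \<alpha> n) (cis \<theta>))"] by linarith
    qed
    have cis_diff: "cis differentiable (at \<theta>)" for \<theta>
      unfolding differentiable_def by (rule exI, rule has_derivative_cis, rule has_derivative_ident)
    have poly_diff: "(\<lambda>\<theta>. poly P (cis \<theta>)) differentiable (at \<theta>)" for P \<theta>
      by (rule differentiable_compose[of "poly P" cis])
        (use cis_diff poly_DERIV in \<open>auto simp: differentiable_def[of "poly P"] has_field_derivative_def\<close>)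
    have "\<gamma> differentiable_on UNIV"
      unfolding \<gamma>_def differentiable_on_def
      by (intro ballI differentiable_divide differentiable_mult poly_diff cis_diff) (simp_all add: ta_nz)
    \<comment> \<open>A differentiable image of the real line in the plane is a null set and cannot
      cover \<open>V\<close>.\<close>
    then have "negligible (range \<gamma>)"
      by (intro negligible_differentiable_image_lowdim) auto
    then obtain \<beta> where \<beta>: "\<beta> \<in> V" "\<beta> \<notin> range \<gamma>"
      using V negligible_subset by blast
    have \<phi>_top: "\<phi> \<beta> \<in> topspace (polydisk p)"
      using \<beta>(1) T openin_subset by (auto simp: V_def)
    interpret even_period p "p div 2" "\<phi> \<beta>" using period[OF \<phi>_top] .
    have "all_gaps_open p (\<phi> \<beta>)"
    proof (rule all_gaps_open_if_no_closed_gap)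
      fix z assume z: "cmod z = 1"
      have cz: "cis (Arg z) = z" using z by (rule cis_Arg_unit)
      \<comment> \<open>The first n factors do not involve the altered parameter.\<close>
      have cong: "tcol_fst (\<phi> \<beta>) u v n = tcol_fst \<alpha> u v n" "tcol_snd (\<phi> \<beta>) u v n = tcol_snd \<alpha> u v n" for u v
        by (rule tcol_cong; simp add: \<phi>_def)+
      have nz: "z * poly (ta \<alpha> n) z \<noteq> 0" using ta_nz[of "Arg z"] z by (auto simp: cz)
      have "\<beta> \<noteq> \<gamma> (Arg z)" using \<beta>(2) by auto
      then have "poly (tc \<alpha> n) z - \<beta> * (z * poly (ta \<alpha> n) z) \<noteq> 0"
        unfolding \<gamma>_def cz nonzero_eq_divide_eq[OF nz] by simp
      moreover have "rho (\<phi> \<beta> n) \<noteq> 0"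
        using in_disk rho_sq(1)[of "\<phi> \<beta> n"] n by auto
      ultimately show "poly (tc (\<phi> \<beta>) p) z \<noteq> 0"
        unfolding n poly_tcol_Suc cong by (simp add: \<phi>_def)
    qed
    then have "\<phi> \<beta> \<in> ?G \<inter> T" using \<phi>_top \<beta>(1) by (auto simp: V_def)
    then show "?G \<inter> T \<noteq> {}" by blast
  qed
qed

end
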